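(* For all real $k>0$ and real $x$ with $|x|<k$, $$\beta_k(x+k)=\frac{\ln 2}{k}+\sum_{m=1}^\infty\frac{(-1)^m(1-2^{-m})\,\zeta(m+1)}{k^{m+1}}\,x^m.$$
   Context: For $k>0$ and $y>0$, the Nielsen $k$-beta function is $\beta_k(y)=\int_0^1\frac{t^{y-1}}{1+t^k}\,dt$. $\zeta$ is the Riemann zeta function. *)

theory Defs
  imports "HOL-Analysis.Analysis"
begin

text \<open>The integrand is evaluated on the open unit interval, where \<open>powr\<close> agrees with the usual real
  power; the integral is a Lebesgue integral, finite for \<open>k > 0\<close>, \<open>y > 0\<close>.\<close>

definition nielsen_beta :: "real \<Rightarrow> real \<Rightarrow> real" where
  "nielsen_beta k y = (LBINT t:{0<..<1}. t powr (y - 1) / (1 + t powr k))"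

text \<open>The Riemann zeta function on the half-line \<open>s > 1\<close>, where it is given by its Dirichlet series;
  no meaning is attached to the values at \<open>s \<le> 1\<close>.\<close>

definition riemann_zeta :: "real \<Rightarrow> real" where
  "riemann_zeta s = (\<Sum>n. 1 / real (Suc n) powr s)"

end

theory Submission
  imports Defs
begin

text \<open>Since \<open>t powr (y - 1) / (1 + t powr k)\<close> and its shift \<open>y \<rightarrow> y + k\<close> add up to \<open>t powr (y - 1)\<close>,
  the function \<open>\<beta>\<close> satisfies \<open>\<beta>(y) + \<beta>(y + k) = 1 / y\<close>; as \<open>0 \<le> \<beta>(y) \<le> 1 / y\<close>, iterating gives
  \<open>\<beta>(x + k) = (\<Sum>n\<ge>1. (-1)^(n - 1) / (x + n k))\<close>. Expanding each \<open>1 / (n + x / k)\<close> as a finite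
  geometric sum, the remainders are dominated by \<open>\<bar>x / k\<bar>^M / n\<^sup>2\<close> and disappear in the limit, so
  only finite sums of (conditionally convergent) series are ever interchanged. The coefficients here are
  the values \<open>\<eta>(m + 1)\<close> of the alternating zeta function, with \<open>\<eta>(1) = ln 2\<close> and
  \<open>\<eta>(s) = (1 - 2 powr (1 - s)) \<zeta>(s)\<close>.\<close>

section \<open>The power integral over the unit interval\<close>

lemma powr_integral_unit_interval:
  fixes y :: real
  assumes "y > 0"
  shows "set_integrable lborel {0<..<1} (\<lambda>t. t powr (y - 1))"
    and "(LBINT t:{0<..<1}. t powr (y - 1)) = 1 / y"
proof -
  let ?F = "\<lambda>t::real. t powr y / y"
  have D: "DERIV ?F t :> t powr (y - 1)" if "t > 0" for t
    using that assms by (auto intro!: derivative_eq_intros simp: field_simps powr_diff)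
  have C: "isCont (\<lambda>t. t powr (y - 1)) t" if "t > 0" for t :: real
    using that by (intro continuous_intros) auto
  have L0: "((?F \<circ> real_of_ereal) \<longlongrightarrow> 0) (at_right (ereal 0))"
  proof -
    have "(?F \<longlongrightarrow> 0 powr y / y) (at_right 0)"
      using assms by (intro tendsto_intros tendsto_powr2) (auto simp: eventually_at_filter)
    then show ?thesis
      using assms by (simp add: ereal_tendsto_simps)
  qed
  have L1: "((?F \<circ> real_of_ereal) \<longlongrightarrow> 1 / y) (at_left (ereal 1))"
  proof -
    have "(?F \<longlongrightarrow> 1 powr y / y) (at_left 1)"
      using assms by (intro tendsto_intros) auto
    then show ?thesis
      by (simp only: ereal_tendsto_simps powr_one_eq_one)
  qed
  \<comment> \<open>For \<open>y < 1\<close> the integrand is unbounded at 0, so only one-sided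
    limits of the antiderivative are used at the endpoints; nonnegativity yields integrability along
    with the value.\<close>
  note FTC = interval_integral_FTC_nonneg[of "ereal 0" "ereal 1" ?F "\<lambda>t. t powr (y - 1)",
      OF _ _ _ _ L0 L1]
  show "set_integrable lborel {0<..<1} (\<lambda>t. t powr (y - 1))"
    using FTC(1) D C by simp
  have "(LBINT t=ereal 0..ereal 1. t powr (y - 1)) = 1 / y - 0"
    by (rule FTC(2)) (use D C in auto)
  then show "(LBINT t:{0<..<1}. t powr (y - 1)) = 1 / y"
    by (simp only: interval_lebesgue_integral_le_eq ereal_less_eq zero_le_one einterval_eq diff_zero)
qed

section \<open>Shift identity and alternating series of the beta function\<close>

context
  fixes k y :: real
  assumes y: "y > 0"
begin

lemma nielsen_beta_integrable:
  "set_integrable lborel {0<..<1} (\<lambda>t. t powr (y - 1) / (1 + t powr k))"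
proof (rule set_integrable_bound[OF powr_integral_unit_interval(1)[OF y]])
  show "set_borel_measurable lborel {0<..<1} (\<lambda>t. t powr (y - 1) / (1 + t powr k))"
    unfolding set_borel_measurable_def by measurable
  have "t powr (y - 1) / (1 + t powr k) \<le> t powr (y - 1)" for t
    using divide_left_mono[of 1 "1 + t powr k" "t powr (y - 1)"] by (simp add: add_pos_nonneg)
  then show "AE t in lborel. t \<in> {0<..<1} \<longrightarrow>
      norm (t powr (y - 1) / (1 + t powr k)) \<le> norm (t powr (y - 1))"
    by (auto simp: add_pos_nonneg abs_of_pos)
qed

lemma nielsen_beta_nonneg: "0 \<le> nielsen_beta k y"
  unfolding nielsen_beta_def set_lebesgue_integral_def
  by (intro Bochner_Integration.integral_nonneg) (auto simp: indicator_def)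

end

lemma nielsen_beta_add_shift:
  assumes "y > 0" "y + k > 0"
  shows "nielsen_beta k y + nielsen_beta k (y + k) = 1 / y"
proof -
  have split: "t powr (y - 1) / (1 + t powr k) + t powr (y + k - 1) / (1 + t powr k) = t powr (y - 1)"
    if "t \<in> {0<..<1}" for t
  proof -
    have "1 + t powr k > 0" by (simp add: add_pos_nonneg)
    moreover have "t powr (y + k - 1) = t powr (y - 1) * t powr k"
      by (simp add: powr_add[symmetric] algebra_simps)
    ultimately show ?thesis
      by (simp add: add_divide_distrib[symmetric] divide_eq_eq distrib_left)
  qed
  have "nielsen_beta k y + nielsen_beta k (y + k)
      = (LBINT t:{0<..<1}. t powr (y - 1) / (1 + t powr k) + t powr (y + k - 1) / (1 + t powr k))"
    unfolding nielsen_beta_def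
    by (rule set_integral_add(2)[symmetric]) (use assms in \<open>auto intro: nielsen_beta_integrable\<close>)
  also have "\<dots> = (LBINT t:{0<..<1}. t powr (y - 1))"
    by (rule set_lebesgue_integral_cong) (use split in auto)
  finally show ?thesis
    using powr_integral_unit_interval(2)[OF assms(1)] by simp
qed

lemma nielsen_beta_partial_fractions:
  assumes "k > 0" "y > 0"
  shows "(\<lambda>n. (-1) ^ n / (y + real n * k)) sums nielsen_beta k y"
proof -
  have pos: "y + real n * k > 0" for n
    using assms by (simp add: add_pos_nonneg)
  have step: "nielsen_beta k (y + real n * k) + nielsen_beta k (y + real (Suc n) * k)
      = 1 / (y + real n * k)" for n
    using nielsen_beta_add_shift[of "y + real n * k" k] pos[of n] pos[of "Suc n"]
    by (simp add: algebra_simps)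
  \<comment> \<open>Unrolling the shift identity \<open>N\<close> times leaves exactly one signed
    beta value as the error.\<close>
  have rem: "nielsen_beta k y - (\<Sum>n<N. (-1) ^ n / (y + real n * k))
      = (-1) ^ N * nielsen_beta k (y + real N * k)" for N
  proof (induction N)
    case (Suc N)
    have "(-1) ^ N / (y + real N * k) = (-1) ^ N * (1 / (y + real N * k))" by simp
    also note step[of N, symmetric]
    finally show ?case using Suc by (simp add: distrib_left)
  qed simp
  have "nielsen_beta k (y + real n * k) \<le> 1 / (y + real n * k)" for n
    using step[of n] nielsen_beta_nonneg[OF pos[of "Suc n"], of k] by linarith
  then have bd: "norm ((\<Sum>n<N. (-1) ^ n / (y + real n * k)) - nielsen_beta k y)
      \<le> 1 / (y + real N * k)" for N
    using rem[of N] nielsen_beta_nonneg[OF pos[of N], of k]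
    by (subst norm_minus_commute) (simp add: abs_mult power_abs)
  have "filterlim (\<lambda>n. y + real n * k) at_top sequentially"
    using assms by (intro filterlim_tendsto_add_at_top[OF tendsto_const]
        filterlim_at_top_mult_tendsto_pos[OF tendsto_const] filterlim_real_sequentially) auto
  then have "(\<lambda>n. 1 / (y + real n * k)) \<longlonglongrightarrow> 0"
    by (intro tendsto_divide_0[OF tendsto_const] filterlim_at_top_imp_at_infinity)
  then have "(\<lambda>N. (\<Sum>n<N. (-1) ^ n / (y + real n * k)) - nielsen_beta k y) \<longlonglongrightarrow> 0"
    by (rule Lim_null_comparison[rotated]) (use bd in auto)
  then show ?thesis
    unfolding sums_def by (simp add: LIM_zero_iff)
qed

section \<open>Alternating zeta values\<close>

lemma summable_inverse_Suc_power:
  assumes "m \<ge> 2"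
  shows "summable (\<lambda>n. 1 / real (Suc n) ^ m)"
  using inverse_power_summable[where ?'a = real, OF assms] summable_Suc_iff[of "\<lambda>n. 1 / real n ^ m"]
  by (simp add: inverse_eq_divide)

text \<open>Exponent 1 converges only conditionally and is the alternating harmonic series; higher
  exponents converge absolutely.\<close>

lemma summable_alternating_Suc_power:
  "summable (\<lambda>n. (-1) ^ n / real (Suc n) ^ Suc m)"
proof (cases m)
  case 0
  then show ?thesis
    using alternating_harmonic_series_sums by (simp add: sums_iff)
next
  case (Suc l)
  have "summable (\<lambda>n. 1 / real (Suc n) ^ Suc m)"
    by (rule summable_inverse_Suc_power) (simp add: Suc)
  then show ?thesis
    by (rule summable_comparison_test'[where N = 0]) (simp add: power_abs)
qed

text \<open>Subtract the alternating series from the zeta series. Index \<open>n\<close> stands for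
  the integer \<open>n + 1\<close>, so terms cancel at even \<open>n\<close> and double at odd
  \<open>n = 2 * j + 1\<close>, giving \<open>2 / (2 * (j + 1)) ^ (m + 1)\<close>. The difference is
  therefore \<open>1 / 2 ^ m\<close> times the zeta series itself.\<close>

lemma alternating_zeta_eq:
  assumes "m \<ge> 1"
  shows "(\<Sum>n. (-1) ^ n / real (Suc n) ^ Suc m) = (1 - 1 / 2 ^ m) * riemann_zeta (real m + 1)"
proof -
  let ?f = "\<lambda>n. 1 / real (Suc n) ^ Suc m"
  let ?g = "\<lambda>n. (-1) ^ n / real (Suc n) ^ Suc m"
  have sf: "summable ?f"
    by (rule summable_inverse_Suc_power) (use assms in simp)
  have zeta: "riemann_zeta (real m + 1) = suminf ?f"
    unfolding riemann_zeta_def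
  proof (rule arg_cong[where f = suminf], rule ext)
    fix n
    have "real (Suc n) powr (real m + 1) = real (Suc n) powr real (Suc m)"
      by (simp add: add.commute)
    also have "\<dots> = real (Suc n) ^ Suc m"
      by (rule powr_realpow) simp
    finally show "1 / real (Suc n) powr (real m + 1) = ?f n"
      by simp
  qed
  have even_or: "even n" if "n \<notin> range (\<lambda>j. 2 * j + 1)" for n :: nat
    using that by (metis oddE rangeI)
  have "(\<lambda>n. ?f n - ?g n) sums (suminf ?f - suminf ?g)"
    by (intro sums_diff summable_sums sf summable_alternating_Suc_power)
  \<comment> \<open>Reindexing along the odd numbers omits only vanishing terms.\<close>
  then have "(\<lambda>j. ?f (2 * j + 1) - ?g (2 * j + 1)) sums (suminf ?f - suminf ?g)"
    by (subst sums_mono_reindex[of "\<lambda>j. 2 * j + 1" "\<lambda>n. ?f n - ?g n"])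
      (use even_or in \<open>auto simp: strict_mono_def\<close>)
  moreover have "?f (2 * j + 1) - ?g (2 * j + 1) = 1 / 2 ^ m * ?f j" for j
  proof -
    have "real (Suc (2 * j + 1)) ^ Suc m = 2 ^ Suc m * real (Suc j) ^ Suc m"
      by (subst power_mult_distrib[symmetric]) (simp add: algebra_simps)
    then show ?thesis
      by (simp del: of_nat_Suc)
  qed
  ultimately have "(\<lambda>j. 1 / 2 ^ m * ?f j) sums (suminf ?f - suminf ?g)"
    by simp
  moreover have "(\<lambda>j. 1 / 2 ^ m * ?f j) sums (1 / 2 ^ m * suminf ?f)"
    by (intro sums_mult summable_sums sf)
  ultimately have "suminf ?f - suminf ?g = 1 / 2 ^ m * suminf ?f"
    by (rule sums_unique2)
  then show ?thesis
    unfolding zeta by (simp add: algebra_simps)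
qed

section \<open>From the geometric expansion to the power series\<close>

lemma inverse_add_geometric_remainder:
  fixes c q :: real
  assumes "c \<noteq> 0" "c + q \<noteq> 0"
  shows "1 / (c + q) = (\<Sum>m<M. (-q) ^ m / c ^ Suc m) + (- q / c) ^ M / (c + q)"
proof (induction M)
  case (Suc M)
  have "(- q / c) ^ M / (c + q) = (-q) ^ M / c ^ Suc M + (- q / c) ^ Suc M / (c + q)"
  proof -
    \<comment> \<open>The quotient reproduces itself with factor \<open>- q / c\<close>, so each
      step splits one more term off the remainder.\<close>
    have "1 / (c + q) = 1 / c + (- q / c) / (c + q)"
      using assms by (subst add_frac_eq) auto
    then have "(- q / c) ^ M * (1 / (c + q)) = (- q / c) ^ M * (1 / c + (- q / c) / (c + q))"
      by (rule arg_cong)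
    also have "(- q / c) ^ M * (1 / c + (- q / c) / (c + q))
        = (-q) ^ M / c ^ Suc M + (- q / c) ^ Suc M / (c + q)"
      unfolding distrib_left[of "(- q / c) ^ M"]
      by (simp only: power_divide power_Suc2 times_divide_eq_right mult_1_right
          divide_divide_eq_left[of _ "c ^ M" c])
    finally show ?thesis by simp
  qed
  then show ?case using Suc by simp
qed simp

text \<open>Summing the exact finite expansion over \<open>n\<close> writes \<open>S\<close> minus a
  partial sum in \<open>m\<close> as the sum of the remainders, which is at most a constant times a
  power of \<open>\<bar>q\<bar>\<close>.\<close>

lemma alternating_zeta_power_series:
  fixes q S :: real
  assumes q: "\<bar>q\<bar> < 1"
    and S: "(\<lambda>n. (-1) ^ n / (real (Suc n) + q)) sums S"
  shows "(\<lambda>m. (-q) ^ m * (\<Sum>n. (-1) ^ n / real (Suc n) ^ Suc m)) sums S"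
proof -
  let ?eta = "\<lambda>m. \<Sum>n. (-1) ^ n / real (Suc n) ^ Suc m"
  define C where "C = (\<Sum>n. 1 / real (Suc n) ^ 2) / (1 - \<bar>q\<bar>)"
  define R where "R = (\<lambda>M n. (-1) ^ n * ((- q / real (Suc n)) ^ M / (real (Suc n) + q)))"
  \<comment> \<open>The exponent must be positive: one factor \<open>1 / real (Suc n)\<close> comes
    from the power and one from the denominator, whereas \<open>R 0 n\<close> decays only like
    \<open>1 / n\<close>.\<close>
  have R_bound: "\<bar>R (Suc M) n\<bar> \<le> \<bar>q\<bar> ^ Suc M / (1 - \<bar>q\<bar>) * (1 / real (Suc n) ^ 2)" for M n
  proof -
    let ?c = "real (Suc n)"
    have c: "?c \<ge> 1" by simp
    \<comment> \<open>As \<open>?c \<ge> 1\<close>, the denominator stays comparable to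
      \<open>?c\<close> uniformly in \<open>n\<close>.\<close>
    have "?c * (1 - \<bar>q\<bar>) \<le> ?c + q"
    proof -
      have "\<bar>q\<bar> \<le> ?c * \<bar>q\<bar>" using mult_right_mono[OF c, of "\<bar>q\<bar>"] by simp
      then show ?thesis unfolding right_diff_distrib mult_1_right by linarith
    qed
    moreover have "?c \<le> ?c ^ Suc M"
      using power_increasing[of 1 "Suc M" ?c] by simp
    moreover have "?c * (1 - \<bar>q\<bar>) > 0" using q c by simp
    ultimately have "?c * (?c * (1 - \<bar>q\<bar>)) \<le> ?c ^ Suc M * (?c + q)" and "?c + q > 0"
      by (auto intro!: mult_mono simp del: of_nat_Suc power_Suc)
    moreover have "\<bar>R (Suc M) n\<bar> = \<bar>q\<bar> ^ Suc M / (?c ^ Suc M * (?c + q))"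
      using \<open>?c + q > 0\<close> unfolding R_def
      by (simp add: abs_mult power_abs power_divide del: of_nat_Suc power_Suc)
    moreover have "\<bar>q\<bar> ^ Suc M / (1 - \<bar>q\<bar>) * (1 / ?c ^ 2) = \<bar>q\<bar> ^ Suc M / (?c * (?c * (1 - \<bar>q\<bar>)))"
      by (simp add: power2_eq_square mult_ac del: of_nat_Suc power_Suc)
    moreover have "?c * (?c * (1 - \<bar>q\<bar>)) > 0" using q c by (simp del: of_nat_Suc)
    ultimately show ?thesis
      by (simp only:) (rule divide_left_mono, auto simp del: of_nat_Suc power_Suc intro!: mult_pos_pos)
  qed
  have R_eq: "(-1) ^ n / (real (Suc n) + q)
      - (\<Sum>m<M. (-q) ^ m * ((-1) ^ n / real (Suc n) ^ Suc m)) = R M n" for M n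
  proof -
    have "(\<Sum>m<M. (-q) ^ m * ((-1) ^ n / real (Suc n) ^ Suc m))
        = (-1) ^ n * (\<Sum>m<M. (-q) ^ m / real (Suc n) ^ Suc m)"
      by (simp add: sum_distrib_left mult_ac del: of_nat_Suc power_Suc)
    moreover have "1 / (real (Suc n) + q) = (\<Sum>m<M. (-q) ^ m / real (Suc n) ^ Suc m)
        + (- q / real (Suc n)) ^ M / (real (Suc n) + q)"
      by (rule inverse_add_geometric_remainder) (use q in auto)
    then have "(-1) ^ n * (1 / (real (Suc n) + q)) = (-1) ^ n *
        ((\<Sum>m<M. (-q) ^ m / real (Suc n) ^ Suc m)
          + (- q / real (Suc n)) ^ M / (real (Suc n) + q))"
      by (rule arg_cong)
    ultimately show ?thesis
      unfolding R_def by (simp add: distrib_left del: of_nat_Suc power_Suc)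
  qed
  \<comment> \<open>The only interchange of summations: finitely many \<open>m\<close>, so
    conditional convergence in \<open>n\<close> suffices.\<close>
  have "(\<lambda>n. \<Sum>m<M. (-q) ^ m * ((-1) ^ n / real (Suc n) ^ Suc m))
      sums (\<Sum>m<M. (-q) ^ m * ?eta m)" for M
    by (intro sums_sum sums_mult summable_sums summable_alternating_Suc_power)
  from sums_diff[OF S this]
  have R_sums: "R M sums (S - (\<Sum>m<M. (-q) ^ m * ?eta m))" for M
    by (simp only: R_eq)
  have rem: "norm ((\<Sum>m<Suc M. (-q) ^ m * ?eta m) - S) \<le> C * \<bar>q\<bar> ^ Suc M" for M
  proof -
    let ?b = "\<lambda>n. \<bar>q\<bar> ^ Suc M / (1 - \<bar>q\<bar>) * (1 / real (Suc n) ^ 2)"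
    have sb: "summable ?b"
      by (intro summable_mult summable_inverse_Suc_power) simp
    have "S - (\<Sum>m<Suc M. (-q) ^ m * ?eta m) = suminf (R (Suc M))"
      using R_sums[of "Suc M"] by (simp only: sums_iff)
    moreover have "\<bar>suminf (R (Suc M))\<bar> \<le> suminf ?b"
      using norm_suminf_le[OF _ sb, of "R (Suc M)"] R_bound by (simp only: real_norm_def)
    moreover have "suminf ?b = C * \<bar>q\<bar> ^ Suc M"
      unfolding C_def by (subst suminf_mult) (auto intro!: summable_inverse_Suc_power simp del: of_nat_Suc)
    ultimately show ?thesis
      by (subst norm_minus_commute) (simp only: real_norm_def)
  qed
  have "(\<lambda>M. C * \<bar>q\<bar> ^ Suc M) \<longlonglongrightarrow> 0"
    using q by (intro tendsto_mult_right_zero LIMSEQ_Suc LIMSEQ_power_zero) simp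
  then have "(\<lambda>M. (\<Sum>m<Suc M. (-q) ^ m * ?eta m) - S) \<longlonglongrightarrow> 0"
    by (rule Lim_null_comparison[rotated]) (use rem in auto)
  then have "(\<lambda>M. \<Sum>m<Suc M. (-q) ^ m * ?eta m) \<longlonglongrightarrow> S"
    by (simp only: LIM_zero_iff)
  \<comment> \<open>Undoes the index shift that the remainder bound required.\<close>
  then show ?thesis
    unfolding sums_def by (rule LIMSEQ_imp_Suc)
qed

text \<open>Convergence is stated separately because \<open>suminf\<close> is a total
  operator.\<close>

theorem theorem5p4:
  fixes k x :: real and a :: "nat \<Rightarrow> real"
  assumes "k > 0" and "\<bar>x\<bar> < k"
  defines "a \<equiv> \<lambda>m. (-1) ^ m * (1 - 1 / 2 ^ m) * riemann_zeta (real m + 1) / k ^ (m + 1) * x ^ m"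
  shows "summable (\<lambda>m. a (Suc m))
    \<and> nielsen_beta k (x + k) = ln 2 / k + (\<Sum>m. a (Suc m))"
proof -
  let ?eta = "\<lambda>m. \<Sum>n. (-1) ^ n / real (Suc n) ^ Suc m"
  define b where "b = (\<lambda>m. (- (x / k)) ^ m * ?eta m)"
  \<comment> \<open>Scaling by \<open>k\<close> turns the denominators into
    \<open>real (Suc n) + x / k\<close>, the form expanded above with
    \<open>q = x / k\<close>.\<close>
  have "(\<lambda>n. k * ((-1) ^ n / (x + k + real n * k))) sums (k * nielsen_beta k (x + k))"
    by (intro sums_mult nielsen_beta_partial_fractions) (use assms in auto)
  moreover have "k * ((-1) ^ n / (x + k + real n * k)) = (-1) ^ n / (real (Suc n) + x / k)" for n
  proof -
    have "x + k + real n * k = k * (real (Suc n) + x / k)"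
      using assms(1) by (simp add: field_simps)
    then show ?thesis using assms(1) by simp
  qed
  ultimately have "b sums (k * nielsen_beta k (x + k))"
    unfolding b_def by (intro alternating_zeta_power_series) (use assms in auto)
  then have "(\<lambda>m. b m / k) sums nielsen_beta k (x + k)"
    using sums_divide[of b _ k] assms(1) by fastforce
  \<comment> \<open>The term \<open>m = 0\<close> is split off: its coefficient is the alternating
    harmonic sum, and the zeta form applies from \<open>m = 1\<close> on.\<close>
  then have "(\<lambda>m. b (Suc m) / k) sums (nielsen_beta k (x + k) - b 0 / k)"
    using sums_Suc_iff[of "\<lambda>m. b m / k"] by simp
  moreover have "b 0 = ln 2"
    using alternating_harmonic_series_sums by (simp add: b_def sums_iff)
  moreover have "b (Suc m) / k = a (Suc m)" for m
    unfolding b_def a_def alternating_zeta_eq[of "Suc m", simplified]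
    using assms(1) by (subst alternating_zeta_eq)
      (auto simp: power_minus[of "x / k"] power_divide mult_ac power_Suc2[of k] simp del: power_Suc)
  ultimately have "(\<lambda>m. a (Suc m)) sums (nielsen_beta k (x + k) - ln 2 / k)"
    by simp
  then show ?thesis
    by (simp add: sums_iff)
qed

end
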